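(* Suppose $Y$ is a continuous image of a product $X=\prod_{i\in I}X_i$ of compacta. Then $\chi_K Nt(Y)\leq\sup_{i\in I}w(X_i)$.
   Context: A compactum is a compact Hausdorff space; $w(\cdot)$ is weight. Families of open sets are ordered by inclusion; a family is $\kappa^{\mathrm{op}}$-like if no member is contained in $\kappa$-many members. For $E\subseteq Y$, $\chi Nt(E,Y)$ is the least $\kappa\geq\omega$ such that $E$ has a $\kappa^{\mathrm{op}}$-like neighborhood base (family of open sets containing $E$ such that every open set containing $E$ contains a member). $\chi_K Nt(Y)$ is the supremum of $\chi Nt(K,Y)$ over compact $K\subseteq Y$.
   Formalization: Y is assumed to be Hausdorff (the claim fails for some non-Hausdorff continuous images), and the bound is max(ω, sup w(X_i)), i.e. weights are counted as infinite, since χ_K Nt(Y) ≥ ω always. *)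

theory Defs
  imports "HOL-Analysis.Analysis"
begin

text \<open>Cardinals are represented by (carrier) sets, compared via the library's
  card_of and the relations ordLeq / ordLess (written with o-subscripted orders).\<close>

definition is_base_of :: "'a topology \<Rightarrow> 'a set set \<Rightarrow> bool" where
  "is_base_of X \<B> \<longleftrightarrow> (\<forall>B\<in>\<B>. openin X B) \<and> openin X = arbitrary union_of (\<lambda>V. V \<in> \<B>)"

definition weight_le :: "'a topology \<Rightarrow> 'k set \<Rightarrow> bool" where
  "weight_le X Kap \<longleftrightarrow> (\<exists>\<B>. is_base_of X \<B> \<and> (card_of \<B>, card_of Kap) \<in> ordLeq)"

definition op_like :: "'k set \<Rightarrow> 'a set set \<Rightarrow> bool" where
  "op_like Kap \<F> \<longleftrightarrow> (\<forall>U\<in>\<F>. (card_of {V\<in>\<F>. U \<subseteq> V}, card_of Kap) \<in> ordLess)"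

definition nbhd_base :: "'a topology \<Rightarrow> 'a set \<Rightarrow> 'a set set \<Rightarrow> bool" where
  "nbhd_base Y E \<F> \<longleftrightarrow> (\<forall>U\<in>\<F>. openin Y U \<and> E \<subseteq> U) \<and>
     (\<forall>W. openin Y W \<and> E \<subseteq> W \<longrightarrow> (\<exists>U\<in>\<F>. U \<subseteq> W))"

text \<open>chiNt(E,Y) \<le> kappa, for an infinite cardinal kappa = |Kap|.  Since lambda^op-like
  implies kappa^op-like for lambda \<le> kappa, this holds iff E has a kappa^op-like
  neighborhood base.\<close>
definition chiNt_le :: "'a topology \<Rightarrow> 'a set \<Rightarrow> 'k set \<Rightarrow> bool" where
  "chiNt_le Y E Kap \<longleftrightarrow> (\<exists>\<F>. nbhd_base Y E \<F> \<and> op_like Kap \<F>)"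

definition chiK_Nt_le :: "'a topology \<Rightarrow> 'k set \<Rightarrow> bool" where
  "chiK_Nt_le Y Kap \<longleftrightarrow> (\<forall>K. compactin Y K \<longrightarrow> chiNt_le Y K Kap)"

end

theory Submission
  imports Defs "HOL-Algebra.Free_Abelian_Groups"
begin

text \<open>
  Let \<open>C\<close> be the preimage of the compact set \<open>K\<close>. For each finite \<open>s \<subseteq> I\<close>, the open
  neighborhoods of \<open>C\<close> depending only on the coordinates in \<open>s\<close> have a cofinal subfamily
  \<open>N s\<close> of size at most \<open>\<kappa>\<close>, ordered in type at most \<open>\<kappa>\<close>. Keep \<open>U \<in> N s\<close> only if it contains
  no member of any \<open>N s'\<close> with \<open>s' \<subset> s\<close> and no earlier member of \<open>N s\<close>; the kept sets still
  form a neighborhood base of \<open>C\<close>. If \<open>V\<close> is a neighborhood of \<open>C\<close> depending on the finite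
  set \<open>s\<close> and \<open>V \<subseteq> U\<close> with \<open>U \<in> N t\<close> kept, then the saturation of \<open>V\<close> along \<open>s \<inter> t\<close> is
  still inside \<open>U\<close>; hence \<open>t \<subseteq> s\<close>, and \<open>U\<close> comes no later in \<open>N t\<close> than a fixed member
  contained in that saturation. So \<open>V\<close> lies in fewer than \<open>\<kappa>\<close> kept sets. The base of \<open>K\<close>
  consists of the sets \<open>Y - f(X - U)\<close>, \<open>U\<close> kept: the preimage of each of them contains such
  a \<open>V\<close>.
\<close>

section \<open>Cardinality\<close>

lemma card_of_Fpow_ordLeq_infinite:
  assumes "infinite B" "|A| \<le>o |B|"
  shows "|Fpow A| \<le>o |B|"
proof (cases "finite A")
  case True
  then have "finite (Fpow A)"
    by (simp add: Fpow_Pow_finite)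
  with assms(1) show ?thesis
    by (simp add: ordLess_imp_ordLeq finite_ordLess_infinite2)
next
  case False
  then obtain g where "bij_betw g (Fpow A) A"
    using eqpoll_Fpow unfolding eqpoll_def by blast
  then have "|Fpow A| =o |A|"
    using card_of_ordIso by blast
  with assms(2) show ?thesis
    using ordIso_ordLeq_trans by blast
qed

lemma card_of_finite_UN_ordLess_infinite:
  assumes "infinite B" "finite S" "\<And>s. s \<in> S \<Longrightarrow> |A s| <o |B|"
  shows "|\<Union>s\<in>S. A s| <o |B|"
  using assms(2,3)
proof (induction S)
  case empty
  show ?case using assms(1) by (simp add: finite_ordLess_infinite2)
next
  case (insert s S)
  then show ?case using assms(1) by (simp add: card_of_Un_ordLess_infinite)
qed

text \<open>Pull back the strict part of the well-order \<open>|B|\<close> along an injection of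
  \<open>A\<close> into \<open>B\<close>. Whatever is not strictly after \<open>b\<close> is sent
  into the initial segment up to the image of \<open>b\<close>, and such a segment of an infinite
  cardinal is smaller than the cardinal.\<close>

lemma ex_wf_small_initial_segments:
  assumes "infinite B" "|A| \<le>o |B|"
  shows "\<exists>R. wf R \<and> (\<forall>b\<in>A. |{a \<in> A. (b, a) \<notin> R}| <o |B| )"
proof -
  obtain g where g: "inj_on g A" "g ` A \<subseteq> B"
    using assms(2) card_of_ordLeq by metis
  define R where "R = inv_image ( |B| - Id) g"
  have wo: "well_order_on B |B|"
    by (rule card_of_well_order_on)
  have "wf R"
    unfolding R_def using wo by (simp add: well_order_on_def)
  moreover have "|{a \<in> A. (b, a) \<notin> R}| <o |B|" if "b \<in> A" for b
  proof -
    have gb: "g b \<in> B" using that g by blast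
    have "g a \<in> insert (g b) (underS |B| (g b))" if "a \<in> A" "(b, a) \<notin> R" for a
    proof -
      have "g a \<in> B" using that g by blast
      moreover have "(g b, g a) \<notin> |B| - Id" using that by (simp add: R_def)
      ultimately show ?thesis
        using wo gb unfolding well_order_on_def linear_order_on_def total_on_def underS_def
        by auto
    qed
    then have "|{a \<in> A. (b, a) \<notin> R}| \<le>o |insert (g b) (underS |B| (g b))|"
      using g(1) by (intro card_of_ordLeqI[of g]) (auto intro: inj_on_subset)
    moreover have "|{g b} \<union> underS |B| (g b)| <o |B|"
      using assms(1) gb
      by (intro card_of_Un_ordLess_infinite card_of_underS)
        (auto simp: finite_ordLess_infinite2 card_of_Card_order Field_card_of)
    ultimately show ?thesis
      using ordLeq_ordLess_trans by fastforce
  qed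
  ultimately show ?thesis by blast
qed

section \<open>Sets depending on few coordinates\<close>

text \<open>For \<open>U \<subseteq> P\<close>, this makes \<open>U\<close> a union of fibres of the
  restriction to the coordinates in \<open>s\<close>.\<close>

definition depends_on :: "('i \<Rightarrow> 'a) set \<Rightarrow> 'i set \<Rightarrow> ('i \<Rightarrow> 'a) set \<Rightarrow> bool" where
  "depends_on P s U \<longleftrightarrow> (\<forall>x\<in>U. \<forall>y\<in>P. (\<forall>i\<in>s. x i = y i) \<longrightarrow> y \<in> U)"

text \<open>For \<open>V \<subseteq> P\<close>, this is the preimage of the image of
  \<open>V\<close> under the restriction to \<open>s\<close>, hence the smallest superset of
  \<open>V\<close> in \<open>P\<close> depending only on \<open>s\<close>.\<close>

definition saturate :: "('i \<Rightarrow> 'a) set \<Rightarrow> 'i set \<Rightarrow> ('i \<Rightarrow> 'a) set \<Rightarrow> ('i \<Rightarrow> 'a) set" where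
  "saturate P s V = {y \<in> P. \<exists>x\<in>V. \<forall>i\<in>s. x i = y i}"

lemma depends_on_saturate: "depends_on P s (saturate P s V)"
  unfolding depends_on_def saturate_def by fastforce

lemma saturate_superset: "V \<subseteq> P \<Longrightarrow> V \<subseteq> saturate P s V"
  unfolding saturate_def by auto

text \<open>Splicing: if \<open>x\<close> in \<open>V\<close> agrees with \<open>y\<close> on
  \<open>s \<inter> t\<close>, the point \<open>z\<close> equal to \<open>x\<close> on
  \<open>s\<close> and to \<open>y\<close> elsewhere agrees with \<open>x\<close> on
  \<open>s\<close>, so it lies in \<open>V \<subseteq> U\<close>, and agrees with \<open>y\<close>
  on \<open>t\<close>, so \<open>y\<close> lies in \<open>U\<close>.\<close>

lemma saturate_Int_subset:
  assumes "V \<subseteq> Pi\<^sub>E I T" "depends_on (Pi\<^sub>E I T) s V" "depends_on (Pi\<^sub>E I T) t U" "V \<subseteq> U"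
  shows "saturate (Pi\<^sub>E I T) (s \<inter> t) V \<subseteq> U"
proof
  fix y assume "y \<in> saturate (Pi\<^sub>E I T) (s \<inter> t) V"
  then obtain x where y: "y \<in> Pi\<^sub>E I T" and x: "x \<in> V" and xy: "\<forall>i\<in>s \<inter> t. x i = y i"
    unfolding saturate_def by blast
  define z where "z = (\<lambda>i. if i \<in> s then x i else y i)"
  have xP: "x \<in> Pi\<^sub>E I T" using x assms(1) by blast
  have "z \<in> Pi\<^sub>E I T"
    using xP y unfolding z_def by (auto simp: PiE_iff extensional_def)
  then have "z \<in> V"
    using x assms(2) unfolding depends_on_def z_def by auto
  then have "z \<in> U" using assms(4) by blast
  moreover have "\<forall>i\<in>t. z i = y i" using xy unfolding z_def by auto
  ultimately show "y \<in> U"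
    using y assms(3) unfolding depends_on_def by blast
qed

text \<open>This is openness of the projection to the coordinates in \<open>s\<close>: a box in
  \<open>V\<close> around \<open>x\<close>, with its sides outside \<open>s\<close> relaxed to whole
  factors, stays in the saturation.\<close>

lemma openin_product_saturate:
  assumes "openin (product_topology X I) V"
  shows "openin (product_topology X I) (saturate (topspace (product_topology X I)) s V)"
  unfolding openin_product_topology_alt
proof
  fix y assume "y \<in> saturate (topspace (product_topology X I)) s V"
  then obtain x where y: "y \<in> topspace (product_topology X I)" and x: "x \<in> V"
    and xy: "\<forall>i\<in>s. x i = y i"
    unfolding saturate_def by blast
  obtain U where U: "finite {i \<in> I. U i \<noteq> topspace (X i)}" "\<forall>i\<in>I. openin (X i) (U i)"
    "x \<in> Pi\<^sub>E I U" "Pi\<^sub>E I U \<subseteq> V"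
    using assms x unfolding openin_product_topology_alt by meson
  define W where "W i = (if i \<in> s then U i else topspace (X i))" for i
  have "{i \<in> I. W i \<noteq> topspace (X i)} \<subseteq> {i \<in> I. U i \<noteq> topspace (X i)}"
    unfolding W_def by auto
  then have "finite {i \<in> I. W i \<noteq> topspace (X i)}"
    using U(1) finite_subset by blast
  moreover have "\<forall>i\<in>I. openin (X i) (W i)"
    using U(2) unfolding W_def by auto
  moreover have "y \<in> Pi\<^sub>E I W"
  proof -
    have "y i \<in> W i" if "i \<in> I" for i
      using y U(3) xy that unfolding W_def by (force simp: PiE_iff)
    then show ?thesis using y by (auto simp: PiE_iff)
  qed
  moreover have "Pi\<^sub>E I W \<subseteq> saturate (topspace (product_topology X I)) s V"
  proof
    fix w assume w: "w \<in> Pi\<^sub>E I W"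
    define z where "z = (\<lambda>i. if i \<in> s then w i else x i)"
    have "z \<in> Pi\<^sub>E I U"
      using w U(3) unfolding z_def W_def by (auto simp: PiE_iff extensional_def)
    then have "z \<in> V" using U(4) by blast
    moreover have "w i \<in> topspace (X i)" if "i \<in> I" for i
      using w U(2) openin_subset that unfolding W_def by (fastforce simp: PiE_iff split: if_splits)
    then have "w \<in> topspace (product_topology X I)"
      using w by (auto simp: PiE_iff)
    moreover have "\<forall>i\<in>s. z i = w i" unfolding z_def by simp
    ultimately show "w \<in> saturate (topspace (product_topology X I)) s V"
      unfolding saturate_def by blast
  qed
  ultimately show "\<exists>U. finite {i \<in> I. U i \<noteq> topspace (X i)} \<and> (\<forall>i\<in>I. openin (X i) (U i)) \<and>
      y \<in> Pi\<^sub>E I U \<and> Pi\<^sub>E I U \<subseteq> saturate (topspace (product_topology X I)) s V"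
    by blast
qed

lemma depends_on_Union:
  assumes "\<And>U. U \<in> \<U> \<Longrightarrow> depends_on P s U"
  shows "depends_on P s (\<Union>\<U>)"
  using assms unfolding depends_on_def by blast

section \<open>Neighborhoods of compact subsets of a product\<close>

lemma compactin_product_finite_support_nbhd:
  assumes C: "compactin (product_topology X I) C" and W: "openin (product_topology X I) W" "C \<subseteq> W"
  shows "\<exists>s V. finite s \<and> s \<subseteq> I \<and> openin (product_topology X I) V \<and>
    depends_on (topspace (product_topology X I)) s V \<and> C \<subseteq> V \<and> V \<subseteq> W"
proof -
  let ?P = "product_topology X I"
  have "\<exists>B s. x \<in> B \<and> openin ?P B \<and> B \<subseteq> W \<and> finite s \<and> s \<subseteq> I \<and> depends_on (topspace ?P) s B"
    if xC: "x \<in> C" for x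
  proof -
    obtain U where U: "finite {i \<in> I. U i \<noteq> topspace (X i)}" "\<forall>i\<in>I. openin (X i) (U i)"
      "x \<in> Pi\<^sub>E I U" "Pi\<^sub>E I U \<subseteq> W"
      using W xC unfolding openin_product_topology_alt by (meson subsetD)
    have "openin ?P (Pi\<^sub>E I U)"
      using U by (auto simp: openin_PiE_gen)
    moreover have "depends_on (topspace ?P) {i \<in> I. U i \<noteq> topspace (X i)} (Pi\<^sub>E I U)"
    proof -
      have "y \<in> Pi\<^sub>E I U" if "x' \<in> Pi\<^sub>E I U" "y \<in> topspace ?P"
        "\<forall>i\<in>{i \<in> I. U i \<noteq> topspace (X i)}. x' i = y i" for x' y
      proof -
        have "y i \<in> U i" if "i \<in> I" for i
          using \<open>x' \<in> _\<close> \<open>y \<in> _\<close> \<open>\<forall>i\<in>_. x' i = y i\<close> that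
          by (cases "U i = topspace (X i)") (force simp: PiE_iff)+
        then show ?thesis using \<open>y \<in> _\<close> by (auto simp: PiE_iff)
      qed
      then show ?thesis unfolding depends_on_def by blast
    qed
    ultimately show ?thesis using U by blast
  qed
  then obtain B s where B: "\<And>x. x \<in> C \<Longrightarrow> x \<in> B x \<and> openin ?P (B x) \<and> B x \<subseteq> W \<and>
      finite (s x) \<and> s x \<subseteq> I \<and> depends_on (topspace ?P) (s x) (B x)"
    by metis
  have "\<exists>\<F>. finite \<F> \<and> \<F> \<subseteq> B ` C \<and> C \<subseteq> \<Union>\<F>"
    by (rule compactinD[OF C]) (use B in auto)
  \<comment> \<open>Finitely many boxes suffice, so their union depends on the finite union of their
    supports.\<close>
  then obtain D where D: "finite D" "D \<subseteq> C" "C \<subseteq> \<Union>(B ` D)"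
    using finite_subset_image[of _ B C] by metis
  have "depends_on (topspace ?P) (\<Union>(s ` D)) (\<Union>(B ` D))"
  proof (rule depends_on_Union)
    fix U assume "U \<in> B ` D"
    then obtain d where "d \<in> D" "U = B d" by blast
    moreover have "depends_on (topspace ?P) (s d) (B d)"
      using B D(2) \<open>d \<in> D\<close> by blast
    ultimately show "depends_on (topspace ?P) (\<Union>(s ` D)) U"
      unfolding depends_on_def by blast
  qed
  moreover have "finite (\<Union>(s ` D))" "\<Union>(s ` D) \<subseteq> I" "\<Union>(B ` D) \<subseteq> W" "openin ?P (\<Union>(B ` D))"
    using B D by blast+
  ultimately show ?thesis using D(3) by blast
qed

text \<open>Since \<open>C\<close> is compact, finite unions of boxes built from base sets at
  coordinates in \<open>s\<close> suffice. Each such union is coded by finite subsets of a set of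
  size at most \<open>|Kap|\<close>, and passing to finite subsets keeps that bound because
  \<open>Kap\<close> is infinite.\<close>

lemma compactin_product_support_base:
  assumes C: "compactin (product_topology X I) C" and s: "finite s" "s \<subseteq> I"
    and inf: "infinite Kap" and weights: "\<And>i. i \<in> I \<Longrightarrow> weight_le (X i) Kap"
  shows "\<exists>\<N>. |\<N>| \<le>o |Kap| \<and>
    (\<forall>U\<in>\<N>. openin (product_topology X I) U \<and> depends_on (topspace (product_topology X I)) s U \<and> C \<subseteq> U) \<and>
    (\<forall>W. openin (product_topology X I) W \<and> depends_on (topspace (product_topology X I)) s W \<and> C \<subseteq> W
      \<longrightarrow> (\<exists>U\<in>\<N>. U \<subseteq> W))"
proof -
  let ?P = "product_topology X I"
  obtain \<B> where base: "\<And>i. i \<in> I \<Longrightarrow> is_base_of (X i) (\<B> i)"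
    and small: "\<And>i. i \<in> I \<Longrightarrow> |\<B> i| \<le>o |Kap|"
    using weights unfolding weight_le_def by metis
  define box where "box F = {x \<in> topspace ?P. \<forall>(i, b)\<in>F. x i \<in> b}" for F
  define \<N> where "\<N> = {U \<in> Union ` Fpow (box ` Fpow (Sigma s \<B>)). C \<subseteq> U}"
  have open_box: "openin ?P (box F)" if "F \<in> Fpow (Sigma s \<B>)" for F
  proof -
    have "openin ?P {x \<in> topspace ?P. x i \<in> b}" if "(i, b) \<in> F" for i b
    proof (rule openin_continuous_map_preimage)
      have "i \<in> I" "b \<in> \<B> i" using that \<open>F \<in> _\<close> s unfolding Fpow_def by auto
      then show "openin (X i) b" using base unfolding is_base_of_def by blast
      show "continuous_map ?P (X i) (\<lambda>x. x i)"
        using \<open>i \<in> I\<close> by (rule continuous_map_product_projection)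
    qed
    \<comment> \<open>The factor \<open>topspace ?P\<close> covers the case of empty
      \<open>F\<close>, whose intersection alone would be the whole type.\<close>
    then have "openin ?P (topspace ?P \<inter> \<Inter>((\<lambda>(i, b). {x \<in> topspace ?P. x i \<in> b}) ` F))"
      using that by (intro openin_Int_Inter openin_topspace) (auto simp only: Fpow_def)
    moreover have "box F = topspace ?P \<inter> \<Inter>((\<lambda>(i, b). {x \<in> topspace ?P. x i \<in> b}) ` F)"
      unfolding box_def by auto
    ultimately show ?thesis by simp
  qed
  have dep_box: "depends_on (topspace ?P) s (box F)" if "F \<in> Fpow (Sigma s \<B>)" for F
    using that unfolding depends_on_def box_def Fpow_def by fastforce
  have "|Sigma s \<B>| \<le>o |Kap|"
    using s small inf
    by (intro card_of_Sigma_ordLeq_infinite) (auto simp: ordLess_imp_ordLeq finite_ordLess_infinite2)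
  then have "|Fpow (Sigma s \<B>)| \<le>o |Kap|"
    by (rule card_of_Fpow_ordLeq_infinite[OF inf])
  then have "|box ` Fpow (Sigma s \<B>)| \<le>o |Kap|"
    using card_of_image ordLeq_transitive by blast
  then have "|Fpow (box ` Fpow (Sigma s \<B>))| \<le>o |Kap|"
    by (rule card_of_Fpow_ordLeq_infinite[OF inf])
  then have "|Union ` Fpow (box ` Fpow (Sigma s \<B>))| \<le>o |Kap|"
    using card_of_image ordLeq_transitive by blast
  moreover have "|\<N>| \<le>o |Union ` Fpow (box ` Fpow (Sigma s \<B>))|"
    unfolding \<N>_def by (intro card_of_mono1) auto
  ultimately have "|\<N>| \<le>o |Kap|"
    using ordLeq_transitive by blast
  moreover have "openin ?P U \<and> depends_on (topspace ?P) s U \<and> C \<subseteq> U" if UN: "U \<in> \<N>" for U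
  proof -
    obtain \<F> where "\<F> \<in> Fpow (box ` Fpow (Sigma s \<B>))" and \<F>: "U = \<Union>\<F>" "C \<subseteq> U"
      using UN unfolding \<N>_def by auto
    then have sub: "\<F> \<subseteq> box ` Fpow (Sigma s \<B>)"
      using Fpow_subset_Pow by blast
    have "openin ?P (\<Union>\<F>)"
      using sub open_box by blast
    moreover have "depends_on (topspace ?P) s (\<Union>\<F>)"
      using sub dep_box by (intro depends_on_Union) blast
    ultimately show ?thesis using \<F> by blast
  qed
  moreover have "\<exists>U\<in>\<N>. U \<subseteq> W"
    if W: "openin ?P W" "depends_on (topspace ?P) s W" "C \<subseteq> W" for W
  proof -
    have "\<exists>F\<in>Fpow (Sigma s \<B>). x \<in> box F \<and> box F \<subseteq> W" if xC: "x \<in> C" for x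
    proof -
      obtain U where U: "\<forall>i\<in>I. openin (X i) (U i)" "x \<in> Pi\<^sub>E I U" "Pi\<^sub>E I U \<subseteq> W"
        using W(1,3) xC unfolding openin_product_topology_alt by (meson subsetD)
      have "\<exists>b\<in>\<B> i. x i \<in> b \<and> b \<subseteq> U i" if "i \<in> s" for i
      proof -
        have "i \<in> I" using that s by blast
        then have "(arbitrary union_of (\<lambda>V. V \<in> \<B> i)) (U i)"
          using base[of i] U(1) unfolding is_base_of_def by metis
        moreover have "x i \<in> U i" using U(2) \<open>i \<in> I\<close> by auto
        ultimately show ?thesis unfolding arbitrary_union_of_alt by blast
      qed
      then obtain b where b: "\<And>i. i \<in> s \<Longrightarrow> b i \<in> \<B> i \<and> x i \<in> b i \<and> b i \<subseteq> U i"
        by metis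
      define F where "F = (\<lambda>i. (i, b i)) ` s"
      have xP: "x \<in> topspace ?P"
        using xC C compactin_subset_topspace by blast
      have "F \<in> Fpow (Sigma s \<B>)"
        using b s(1) unfolding F_def Fpow_def by auto
      moreover have "x \<in> box F"
        using b xP unfolding box_def F_def by auto
      moreover have "box F \<subseteq> W"
      proof
        fix y assume "y \<in> box F"
        then have y: "y \<in> topspace ?P" "\<And>i. i \<in> s \<Longrightarrow> y i \<in> U i"
          using b unfolding box_def F_def by auto
        \<comment> \<open>\<open>box F\<close> restricts only coordinates in \<open>s\<close>, so
          \<open>y\<close> may leave \<open>Pi\<^sub>E I U\<close> elsewhere. Borrowing those
          coordinates from \<open>x\<close> gives a point of \<open>W\<close>, and \<open>W\<close>
          depends only on \<open>s\<close>.\<close>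
        define z where "z = (\<lambda>i. if i \<in> s then y i else x i)"
        have "z \<in> Pi\<^sub>E I U"
          using y U(2) s(2) unfolding z_def by (auto simp: PiE_iff extensional_def)
        then have "z \<in> W" using U(3) by blast
        then show "y \<in> W"
          using W(2) y(1) unfolding depends_on_def z_def by auto
      qed
      ultimately show ?thesis by blast
    qed
    then obtain F where F: "\<And>x. x \<in> C \<Longrightarrow> F x \<in> Fpow (Sigma s \<B>) \<and> x \<in> box (F x) \<and> box (F x) \<subseteq> W"
      by metis
    have "\<exists>\<F>. finite \<F> \<and> \<F> \<subseteq> (\<lambda>x. box (F x)) ` C \<and> C \<subseteq> \<Union>\<F>"
      by (rule compactinD[OF C]) (use F open_box in auto)
    then obtain \<F> where \<F>: "finite \<F>" "\<F> \<subseteq> (\<lambda>x. box (F x)) ` C" "C \<subseteq> \<Union>\<F>"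
      by blast
    have "\<F> \<subseteq> box ` Fpow (Sigma s \<B>)"
      using \<F>(2) F by blast
    then have "\<F> \<in> Fpow (box ` Fpow (Sigma s \<B>))"
      using \<F>(1) unfolding Fpow_Pow_finite[of "box ` Fpow (Sigma s \<B>)"] by simp
    then have "\<Union>\<F> \<in> \<N>" using \<F>(3) unfolding \<N>_def by blast
    moreover have "\<Union>\<F> \<subseteq> W" using \<F>(2) F by blast
    ultimately show ?thesis by blast
  qed
  ultimately show ?thesis by blast
qed

section \<open>Sparse neighborhood bases\<close>

text \<open>The bound concerns every open neighborhood \<open>V\<close> of \<open>C\<close>, which
  is more than \<open>op_like\<close> asks of the members of the base. This strength survives
  passing to a continuous image, where the preimage of a base member need not belong to
  \<open>\<G>\<close>.\<close>

lemma compactin_product_sparse_nbhd_base: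
  assumes C: "compactin (product_topology X I) C"
    and inf: "infinite Kap" and weights: "\<And>i. i \<in> I \<Longrightarrow> weight_le (X i) Kap"
  shows "\<exists>\<G>. nbhd_base (product_topology X I) C \<G> \<and>
    (\<forall>V. openin (product_topology X I) V \<and> C \<subseteq> V \<longrightarrow> |{U \<in> \<G>. V \<subseteq> U}| <o |Kap| )"
proof -
  let ?P = "product_topology X I"
  let ?T = "topspace ?P"
  have "\<exists>\<N>. |\<N>| \<le>o |Kap| \<and> (\<forall>U\<in>\<N>. openin ?P U \<and> depends_on ?T s U \<and> C \<subseteq> U) \<and>
      (\<forall>W. openin ?P W \<and> depends_on ?T s W \<and> C \<subseteq> W \<longrightarrow> (\<exists>U\<in>\<N>. U \<subseteq> W))"
    if "finite s \<and> s \<subseteq> I" for s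
    using compactin_product_support_base[OF C _ _ inf weights] that by blast
  then have "\<forall>s\<in>{s. finite s \<and> s \<subseteq> I}. \<exists>\<N>. |\<N>| \<le>o |Kap| \<and>
      (\<forall>U\<in>\<N>. openin ?P U \<and> depends_on ?T s U \<and> C \<subseteq> U) \<and>
      (\<forall>W. openin ?P W \<and> depends_on ?T s W \<and> C \<subseteq> W \<longrightarrow> (\<exists>U\<in>\<N>. U \<subseteq> W))"
    by simp
  from bchoice[OF this] obtain N where
    N_all: "\<forall>s\<in>{s. finite s \<and> s \<subseteq> I}. |N s| \<le>o |Kap| \<and>
      (\<forall>U\<in>N s. openin ?P U \<and> depends_on ?T s U \<and> C \<subseteq> U) \<and>
      (\<forall>W. openin ?P W \<and> depends_on ?T s W \<and> C \<subseteq> W \<longrightarrow> (\<exists>U\<in>N s. U \<subseteq> W))" ..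
  have card_N: "|N s| \<le>o |Kap|" if "finite s \<and> s \<subseteq> I" for s
    using N_all that by simp
  have N: "openin ?P U \<and> depends_on ?T s U \<and> C \<subseteq> U" if "finite s \<and> s \<subseteq> I" "U \<in> N s" for s U
    using N_all that by simp
  have cofinal: "\<exists>U\<in>N s. U \<subseteq> W"
    if "finite s \<and> s \<subseteq> I" "openin ?P W" "depends_on ?T s W" "C \<subseteq> W" for s W
    using N_all that by simp
  have "\<exists>R. wf R \<and> (\<forall>M\<in>N s. |{U \<in> N s. (M, U) \<notin> R}| <o |Kap| )" if "finite s \<and> s \<subseteq> I" for s
    by (rule ex_wf_small_initial_segments[OF inf card_N[OF that]])
  then have "\<forall>s\<in>{s. finite s \<and> s \<subseteq> I}. \<exists>R. wf R \<and> (\<forall>M\<in>N s. |{U \<in> N s. (M, U) \<notin> R}| <o |Kap| )"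
    by simp
  from bchoice[OF this] obtain R where
    R_all: "\<forall>s\<in>{s. finite s \<and> s \<subseteq> I}. wf (R s) \<and> (\<forall>M\<in>N s. |{U \<in> N s. (M, U) \<notin> R s}| <o |Kap| )" ..
  have wf_R: "wf (R s)" if "finite s \<and> s \<subseteq> I" for s
    using R_all that by simp
  have R: "|{U \<in> N s. (M, U) \<notin> R s}| <o |Kap|" if "finite s \<and> s \<subseteq> I" "M \<in> N s" for s M
    using R_all that by simp
  \<comment> \<open>Here \<open>(M, U) \<in> R s\<close> means that \<open>M\<close> comes earlier
    than \<open>U\<close>. Taking \<open>M = U\<close> in the last clause is harmless, as a
    well-founded relation is irreflexive.\<close>
  define kept where "kept s = {U \<in> N s. (\<forall>s'. s' \<subset> s \<longrightarrow> (\<forall>M\<in>N s'. \<not> M \<subseteq> U)) \<and>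
      (\<forall>M\<in>N s. M \<subseteq> U \<longrightarrow> (M, U) \<notin> R s)}" for s
  have kept_N: "U \<in> N s" if "U \<in> kept s" for s U
    using that by (simp add: kept_def)
  have kept_minimal: "\<not> M \<subseteq> U" if "U \<in> kept s" "s' \<subset> s" "M \<in> N s'" for s s' U M
    using that by (simp add: kept_def)
  have kept_first: "(M, U) \<notin> R s" if "U \<in> kept s" "M \<in> N s" "M \<subseteq> U" for s U M
    using that by (simp add: kept_def)
  define \<G> where "\<G> = (\<Union>s\<in>{s. finite s \<and> s \<subseteq> I}. kept s)"
  \<comment> \<open>Take the \<open>R s\<close>-minimal \<open>M\<close> among the members of
    \<open>N s\<close> inside \<open>U\<close>. Either \<open>M\<close> contains a member of some
    \<open>N s'\<close> with smaller support, handled by induction, or \<open>M\<close> itself is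
    kept.\<close>
  have refine: "\<exists>G\<in>\<G>. G \<subseteq> U" if "finite s" "s \<subseteq> I" "U \<in> N s" for s U
    using that
  proof (induction s arbitrary: U rule: finite_psubset_induct)
    case (psubset s)
    have "wf (R s)" using psubset by (intro wf_R) simp
    moreover have "U \<in> {M \<in> N s. M \<subseteq> U}" using psubset.prems by simp
    ultimately obtain M where "M \<in> {M \<in> N s. M \<subseteq> U}"
      and min: "\<And>L. (L, M) \<in> R s \<Longrightarrow> L \<notin> {M \<in> N s. M \<subseteq> U}"
      by (rule wfE_min) blast
    then have M: "M \<in> N s" "M \<subseteq> U" by simp_all
    show ?case
    proof (cases "\<exists>s' L. s' \<subset> s \<and> L \<in> N s' \<and> L \<subseteq> M")
      case True
      then obtain s' L where L: "s' \<subset> s" "L \<in> N s'" "L \<subseteq> M" by blast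
      then have "\<exists>G\<in>\<G>. G \<subseteq> L"
        using psubset.IH[of s' L] psubset.prems by blast
      then show ?thesis using L M by blast
    next
      case False
      then have "\<not> L \<subseteq> M" if "s' \<subset> s" "L \<in> N s'" for s' L
        using that by simp
      moreover have "(L, M) \<notin> R s" if "L \<in> N s" "L \<subseteq> M" for L
        using min[of L] that M(2) by auto
      ultimately have "M \<in> kept s"
        using M(1) by (simp add: kept_def)
      then have "M \<in> \<G>" using psubset.hyps psubset.prems(1) by (auto simp: \<G>_def)
      then show ?thesis using M by blast
    qed
  qed
  have "nbhd_base ?P C \<G>"
    unfolding nbhd_base_def
  proof (intro conjI ballI allI impI)
    fix U assume "U \<in> \<G>"
    then obtain s where "finite s \<and> s \<subseteq> I" "U \<in> kept s" by (auto simp: \<G>_def)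
    then show "openin ?P U" "C \<subseteq> U" using N kept_N by simp_all
  next
    fix W assume "openin ?P W \<and> C \<subseteq> W"
    then obtain s V where V: "finite s \<and> s \<subseteq> I" "openin ?P V" "depends_on ?T s V" "C \<subseteq> V" "V \<subseteq> W"
      using compactin_product_finite_support_nbhd[OF C] by meson
    then obtain U where "U \<in> N s" "U \<subseteq> V" using cofinal by blast
    then show "\<exists>U\<in>\<G>. U \<subseteq> W" using refine V by (meson order_trans)
  qed
  moreover have "|{U \<in> \<G>. W \<subseteq> U}| <o |Kap|" if W: "openin ?P W \<and> C \<subseteq> W" for W
  proof -
    obtain s V where V: "finite s \<and> s \<subseteq> I" "openin ?P V" "depends_on ?T s V" "C \<subseteq> V" "V \<subseteq> W"
      using compactin_product_finite_support_nbhd[OF C] W by meson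
    have "V \<subseteq> ?T" using V(2) openin_subset by blast
    \<comment> \<open>One reference set \<open>M t\<close> per subset \<open>t\<close> of the finite
      support \<open>s\<close> is fixed before any kept set is examined; all kept sets containing
      \<open>V\<close> are compared with these finitely many.\<close>
    have "\<exists>M\<in>N t. M \<subseteq> saturate ?T t V" if "t \<subseteq> s" for t
    proof (rule cofinal)
      show "finite t \<and> t \<subseteq> I" using that V(1) finite_subset by blast
      show "openin ?P (saturate ?T t V)" using V(2) by (rule openin_product_saturate)
      show "C \<subseteq> saturate ?T t V" using saturate_superset[OF \<open>V \<subseteq> ?T\<close>] V(4) by blast
    qed (rule depends_on_saturate)
    then obtain M where M: "\<And>t. t \<subseteq> s \<Longrightarrow> M t \<in> N t \<and> M t \<subseteq> saturate ?T t V"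
      by metis
    have "{U \<in> \<G>. W \<subseteq> U} \<subseteq> (\<Union>t\<in>Pow s. {U \<in> N t. (M t, U) \<notin> R t})"
    proof
      fix U assume "U \<in> {U \<in> \<G>. W \<subseteq> U}"
      then obtain t where t: "finite t \<and> t \<subseteq> I" "U \<in> kept t" "V \<subseteq> U"
        using V(5) by (auto simp: \<G>_def)
      have U: "U \<in> N t" using t(2) by (rule kept_N)
      have "saturate ?T (s \<inter> t) V \<subseteq> U"
        using saturate_Int_subset[of V I "\<lambda>i. topspace (X i)" s t U] \<open>V \<subseteq> ?T\<close> V(3) N[OF t(1) U] t(3)
        by simp
      then have MU: "M (s \<inter> t) \<subseteq> U" "M (s \<inter> t) \<in> N (s \<inter> t)"
        using M[of "s \<inter> t"] by blast+
      \<comment> \<open>A proper inclusion would put a member of \<open>N\<close> with smaller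
        support inside \<open>U\<close>, against \<open>U\<close> being kept. So
        \<open>t \<subseteq> s\<close>, and the reference set \<open>M t\<close> inside
        \<open>U\<close> cannot precede \<open>U\<close>.\<close>
      then have "\<not> s \<inter> t \<subset> t" using kept_minimal[OF t(2)] by auto
      then have st: "s \<inter> t = t" by blast
      then have "(M t, U) \<notin> R t" using kept_first[OF t(2)] MU by auto
      then show "U \<in> (\<Union>t\<in>Pow s. {U \<in> N t. (M t, U) \<notin> R t})" using st U by blast
    qed
    moreover have "|\<Union>t\<in>Pow s. {U \<in> N t. (M t, U) \<notin> R t}| <o |Kap|"
    proof (rule card_of_finite_UN_ordLess_infinite[OF inf])
      show "finite (Pow s)" using V(1) by simp
      fix t assume "t \<in> Pow s"
      then show "|{U \<in> N t. (M t, U) \<notin> R t}| <o |Kap|"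
        using R[of t "M t"] M[of t] V(1) finite_subset[of t s] by blast
    qed
    ultimately show ?thesis
      using card_of_mono1 ordLeq_ordLess_trans by blast
  qed
  ultimately show ?thesis by blast
qed

section \<open>Transfer to the continuous image\<close>

text \<open>\<open>Kap\<close> stands for any infinite upper bound of the weights; when their
  supremum is infinite, the bound by it is the instance where \<open>Kap\<close> has that
  size.\<close>

theorem theorem2p19:
  fixes X :: "'i \<Rightarrow> 'a topology" and I :: "'i set"
    and Y :: "'b topology" and f :: "('i \<Rightarrow> 'a) \<Rightarrow> 'b"
    and Kap :: "'k set"
  assumes compacta: "\<And>i. i \<in> I \<Longrightarrow> compact_space (X i) \<and> Hausdorff_space (X i)"
    and Y_compactum: "compact_space Y \<and> Hausdorff_space Y"
    and cont: "continuous_map (product_topology X I) Y f"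
    and onto: "f ` topspace (product_topology X I) = topspace Y"
    and Kap_inf: "infinite Kap"
    and weights: "\<And>i. i \<in> I \<Longrightarrow> weight_le (X i) Kap"
  shows "chiK_Nt_le Y Kap"
  unfolding chiK_Nt_le_def
proof (intro allI impI)
  fix K assume K: "compactin Y K"
  let ?P = "product_topology X I"
  let ?T = "topspace ?P"
  define C where "C = {x \<in> ?T. f x \<in> K}"
  have compact_P: "compact_space ?P"
    using compacta by (simp add: compact_space_product_topology)
  have closed_f: "closed_map ?P Y f"
    using compact_P Y_compactum cont by (simp add: continuous_imp_closed_map)
  have "closedin Y K"
    using K Y_compactum compactin_imp_closedin by blast
  then have "closedin ?P C"
    unfolding C_def using cont closedin_continuous_map_preimage by blast
  then have C: "compactin ?P C"
    using compact_P closedin_compact_space by blast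
  obtain \<G> where \<G>: "nbhd_base ?P C \<G>"
    and sparse: "\<And>V. openin ?P V \<Longrightarrow> C \<subseteq> V \<Longrightarrow> |{U \<in> \<G>. V \<subseteq> U}| <o |Kap|"
    using compactin_product_sparse_nbhd_base[OF C Kap_inf weights] by blast
  \<comment> \<open>\<open>h U\<close> consists of the points of \<open>Y\<close> whose whole fibre
    lies in \<open>U\<close>. It is open because \<open>f\<close> is closed, and it contains
    \<open>K\<close> because the fibres over \<open>K\<close> lie in \<open>C\<close>.\<close>
  define h where "h U = topspace Y - f ` (?T - U)" for U
  have h: "openin Y (h U)" "K \<subseteq> h U" if "U \<in> \<G>" for U
  proof -
    have U: "openin ?P U" "C \<subseteq> U" using \<G> that unfolding nbhd_base_def by blast+
    then have "closedin Y (f ` (?T - U))"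
      using closed_f unfolding closed_map_def by blast
    then show "openin Y (h U)" unfolding h_def by blast
    show "K \<subseteq> h U"
      using U(2) compactin_subset_topspace[OF K] unfolding h_def C_def by blast
  qed
  have "nbhd_base Y K (h ` \<G>)"
    unfolding nbhd_base_def
  proof (intro conjI ballI allI impI)
    fix W assume W: "openin Y W \<and> K \<subseteq> W"
    have "openin ?P {x \<in> ?T. f x \<in> W}"
      using W cont openin_continuous_map_preimage by blast
    moreover have "C \<subseteq> {x \<in> ?T. f x \<in> W}"
      using W unfolding C_def by blast
    ultimately obtain U where "U \<in> \<G>" "U \<subseteq> {x \<in> ?T. f x \<in> W}"
      using \<G> unfolding nbhd_base_def by blast
    \<comment> \<open>By surjectivity each point of \<open>h U\<close> has a nonempty fibre; that
      fibre lies in \<open>U\<close>, so the point lies in \<open>W\<close>.\<close>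
    moreover from this have "h U \<subseteq> W"
      unfolding h_def onto[symmetric] by blast
    ultimately show "\<exists>U\<in>h ` \<G>. U \<subseteq> W" by blast
  qed (use h in auto)
  moreover have "op_like Kap (h ` \<G>)"
    unfolding op_like_def
  proof
    fix A assume "A \<in> h ` \<G>"
    then have A: "openin Y A" "K \<subseteq> A" using h by blast+
    define V where "V = {x \<in> ?T. f x \<in> A}"
    have "openin ?P V"
      unfolding V_def using A cont openin_continuous_map_preimage by blast
    moreover have "C \<subseteq> V" using A unfolding V_def C_def by blast
    ultimately have small: "|{U \<in> \<G>. V \<subseteq> U}| <o |Kap|" by (rule sparse)
    \<comment> \<open>If \<open>A \<subseteq> h U\<close>, then every fibre over \<open>A\<close>
      lies in \<open>U\<close>, that is, \<open>V \<subseteq> U\<close>. Distinct \<open>U\<close>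
      may share an image, which only lowers the count.\<close>
    have "{B \<in> h ` \<G>. A \<subseteq> B} \<subseteq> h ` {U \<in> \<G>. V \<subseteq> U}"
      unfolding V_def h_def by blast
    then have "|{B \<in> h ` \<G>. A \<subseteq> B}| \<le>o |{U \<in> \<G>. V \<subseteq> U}|"
      by (meson card_of_image card_of_mono1 ordLeq_transitive)
    then show "|{B \<in> h ` \<G>. A \<subseteq> B}| <o |Kap|"
      using small ordLeq_ordLess_trans by blast
  qed
  ultimately show "chiNt_le Y K Kap"
    unfolding chiNt_le_def by blast
qed

end
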